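(* Suppose $P_{n,K}$ is full-dimensional, and let $u\in V$ with $u\ge 4$. The inequality $x_u+\sum_{i=1}^{u-1}x_{i,u}\ge 1$ is facet-defining for $P_{n,K}$.
   Context: $V=\{1,\dots,n\}$ and $E$ is the set of all unordered pairs $ij$ of distinct elements of $V$; $x_{i,j}=x_{j,i}$. A $K$-partition $\pi$ is a collection of $K$ non-empty pairwise disjoint subsets (clusters) of $V$ whose union is $V$. The representative of a cluster is its smallest element. The characteristic vector $x^\pi\in\{0,1\}^{|E|+|V|-3}$ of $\pi$ has components $x_4,\dots,x_n$ and $x_{i,j}$ for $ij\in E$, where $x^\pi_{i,j}=1$ if $i,j$ are in the same cluster and $0$ otherwise, and $x^\pi_u=1$ if $u$ is the representative of its cluster and $0$ otherwise. (Representative variables of vertices $1,2,3$ are not coordinates.) $P_{n,K}\subset\mathbb R^{|E|+|V|-3}$ is the convex hull of the characteristic vectors $x^\pi$ of all $K$-partitions $\pi$ of $V$ (equivalently, of all $0/1$ solutions of the integer formulation of the $K$-partitioning problem). It is full-dimensional (dimension $|E|+|V|-3$) if and only if $K\in\{3,\dots,n-2\}$. An inequality is facet-defining for $P_{n,K}$ if it is valid for $P_{n,K}$ and the set of points of $P_{n,K}$ satisfying it with equality has dimension $\dim(P_{n,K})-1$. *)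

theory Defs
  imports "HOL-Analysis.Analysis" "HOL-Library.Disjoint_Sets"
begin

definition verts :: "nat \<Rightarrow> nat set" where
  "verts n = {1..n}"

definition edges :: "nat \<Rightarrow> nat set set" where
  "edges n = {{i, j} | i j. i \<in> verts n \<and> j \<in> verts n \<and> i \<noteq> j}"

datatype coord = Rep nat | Edge "nat set"

text \<open>Names of the coordinates (\<open>|E| + |V| - 3\<close> many when \<open>n \<ge> 3\<close>): the vertices \<open>4, \<dots>, n\<close> and the edges.\<close>

definition coords :: "nat \<Rightarrow> coord set" where
  "coords n = Rep ` {4..n} \<union> Edge ` edges n"

text \<open>
  The ambient space is \<open>real ^ 'd\<close>, where a labelling \<open>lab\<close> names each index in \<open>'d\<close>.
  If \<open>lab\<close> is a bijection from \<open>'d\<close> onto \<open>coords n\<close>, then \<open>real ^ 'd\<close> is the space of all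
  real vectors with coordinates \<open>coords n\<close>, without any superfluous coordinate.
\<close>

definition labelling :: "nat \<Rightarrow> ('d \<Rightarrow> coord) \<Rightarrow> bool" where
  "labelling n lab \<longleftrightarrow> bij_betw lab UNIV (coords n)"

text \<open>Both component functions are meaningful only for indices whose name is in \<open>coords n\<close>.\<close>

definition rep_var :: "('d \<Rightarrow> coord) \<Rightarrow> real ^ 'd \<Rightarrow> nat \<Rightarrow> real" where
  "rep_var lab x u = x $ (inv lab (Rep u))"

definition edge_var :: "('d \<Rightarrow> coord) \<Rightarrow> real ^ 'd \<Rightarrow> nat \<Rightarrow> nat \<Rightarrow> real" where
  "edge_var lab x i j = x $ (inv lab (Edge {i, j}))"

definition k_partition :: "nat \<Rightarrow> nat \<Rightarrow> nat set set \<Rightarrow> bool" where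
  "k_partition n K \<pi> \<longleftrightarrow> partition_on (verts n) \<pi> \<and> card \<pi> = K"

definition is_representative :: "nat set set \<Rightarrow> nat \<Rightarrow> bool" where
  "is_representative \<pi> u \<longleftrightarrow> (\<exists>C\<in>\<pi>. u \<in> C \<and> u = Min C)"

definition char_vec :: "('d::finite \<Rightarrow> coord) \<Rightarrow> nat set set \<Rightarrow> real ^ 'd" where
  "char_vec lab \<pi> = (\<chi> d. case lab d of
      Rep u \<Rightarrow> if is_representative \<pi> u then 1 else 0
    | Edge e \<Rightarrow> if \<exists>C\<in>\<pi>. e \<subseteq> C then 1 else 0)"

definition partition_polytope :: "nat \<Rightarrow> nat \<Rightarrow> ('d::finite \<Rightarrow> coord) \<Rightarrow> (real ^ 'd) set" where
  "partition_polytope n K lab = convex hull {char_vec lab \<pi> | \<pi>. k_partition n K \<pi>}"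

definition full_dimensional :: "'a::euclidean_space set \<Rightarrow> bool" where
  "full_dimensional P \<longleftrightarrow> aff_dim P = int DIM('a)"

text \<open>The inequality \<open>f x \<ge> b\<close> with \<open>f\<close> linear is facet-defining for \<open>P\<close>.\<close>

definition facet_defining :: "'a::euclidean_space set \<Rightarrow> ('a \<Rightarrow> real) \<Rightarrow> real \<Rightarrow> bool" where
  "facet_defining P f b \<longleftrightarrow>
     linear f \<and> (\<forall>x\<in>P. f x \<ge> b) \<and> aff_dim {x \<in> P. f x = b} = aff_dim P - 1"

end

theory Submission
  imports Defs
begin

text \<open>
  The scalar product of \<open>a\<close> with the characteristic vector of a partition is a sum over the blocks
  \<open>C\<close> of \<open>a\<^sub>m + (\<Sum>ij \<subseteq> C. a\<^sub>i\<^sub>j)\<close> with \<open>m = min C\<close> and \<open>a\<^sub>1 = a\<^sub>2 = a\<^sub>3 = 0\<close>. The inequality is tight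
  exactly when the block of \<open>u\<close> contains at most one vertex below \<open>u\<close>. Since \<open>0\<close> does not lie
  on the hyperplane of the inequality, it suffices to show that only \<open>a = 0\<close> is orthogonal to all
  tight characteristic vectors.

  Distributing two vertices \<open>v, w\<close> in all four ways over two blocks with minima \<open>p, q\<close> and taking
  the alternating sum leaves \<open>2 a\<^sub>v\<^sub>w\<close> and a few representative terms. This gives \<open>a\<^sub>v\<^sub>w = 0\<close> for most pairs,
  and \<open>a\<^sub>v\<^sub>w = -a\<^sub>q/2\<close> for \<open>v, w \<le> 3\<close> and every \<open>q \<ge> 4\<close> other than \<open>u\<close>. Moving single vertices between
  blocks that involve \<open>u\<close> shows that \<open>a\<^sub>i\<^sub>u = \<alpha>\<close> is independent of \<open>i < u\<close>, that \<open>\<alpha> = a\<^sub>u + a\<^sub>1\<^sub>2\<close> and that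
  \<open>\<alpha> = a\<^sub>u - a\<^sub>q\<close>. Hence \<open>a\<^sub>q = 0\<close>, and \<open>a\<close> is \<open>a\<^sub>u\<close> times the normal vector of the inequality, so
  \<open>a\<^sub>u = 0\<close> because there is a tight partition.

  Full-dimensionality forces \<open>3 \<le> K \<le> n - 2\<close>: for \<open>K \<ge> n - 1\<close> all blocks have at most two elements,
  so every partition is tight, and for \<open>K \<le> 2\<close> every partition satisfies
  \<open>x\<^sub>1\<^sub>2 + x\<^sub>1\<^sub>3 + x\<^sub>2\<^sub>3 - 2 (\<Sum>v \<ge> 4. x\<^sub>v) = 5 - 2K\<close>.
\<close>

section \<open>Scalar products with characteristic vectors as sums over blocks\<close>

lemma edges_eq: "edges n = {e. e \<subseteq> verts n \<and> card e = 2}"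
  unfolding edges_def by (auto simp: card_2_iff)

definition pair_sum :: "(nat set \<Rightarrow> real) \<Rightarrow> nat set \<Rightarrow> real" where
  "pair_sum a C = (\<Sum>e | e \<subseteq> C \<and> card e = 2. a e)"

lemma pair_sum_singleton [simp]: "pair_sum a {v} = 0"
proof -
  have "{e. e \<subseteq> {v} \<and> card e = 2} = {}"
    by (auto simp: subset_singleton_iff)
  then show ?thesis
    unfolding pair_sum_def by (metis sum.empty)
qed

lemma pair_sum_insert:
  assumes "finite C" "v \<notin> C"
  shows "pair_sum a (insert v C) = pair_sum a C + (\<Sum>j\<in>C. a {v, j})"
proof -
  have split: "{e. e \<subseteq> insert v C \<and> card e = 2}
      = {e. e \<subseteq> C \<and> card e = 2} \<union> (\<lambda>j. {v, j}) ` C" (is "?L = ?M \<union> ?N")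
  proof
    show "?L \<subseteq> ?M \<union> ?N"
    proof
      fix e assume e: "e \<in> ?L"
      then obtain x y where xy: "e = {x, y}" "x \<noteq> y" by (auto simp: card_2_iff)
      show "e \<in> ?M \<union> ?N"
      proof (cases "v \<in> e")
        case True
        then show ?thesis using e xy by (auto simp: insert_commute)
      next
        case False
        then show ?thesis using e by auto
      qed
    qed
    show "?M \<union> ?N \<subseteq> ?L" using assms by (auto simp: card_2_iff)
  qed
  have inj: "inj_on (\<lambda>j. {v, j}) C"
    using assms by (auto simp: inj_on_def doubleton_eq_iff)
  have "pair_sum a (insert v C) = (\<Sum>e\<in>?M. a e) + (\<Sum>e\<in>?N. a e)"
    unfolding pair_sum_def split
    by (rule sum.union_disjoint) (use assms in auto)
  then show ?thesis
    unfolding pair_sum_def by (simp add: sum.reindex[OF inj])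
qed

definition block_sum :: "(nat \<Rightarrow> real) \<Rightarrow> (nat set \<Rightarrow> real) \<Rightarrow> nat set \<Rightarrow> real" where
  "block_sum b a C = b (Min C) + pair_sum a C"

lemma block_sum_insert:
  assumes "finite C" "C \<noteq> {}" "v \<notin> C"
  shows "block_sum b a (insert v C)
    = block_sum b a C + (\<Sum>j\<in>C. a {v, j}) + b (min v (Min C)) - b (Min C)"
  using assms by (simp add: block_sum_def pair_sum_insert)

lemma finite_verts [simp]: "finite (verts n)"
  by (simp add: verts_def)

lemma Min_partition_mem:
  assumes "partition_on A \<pi>" "finite A" "C \<in> \<pi>"
  shows "Min C \<in> C" "Min C \<in> A"
proof -
  have C: "C \<subseteq> A" "C \<noteq> {}" using assms(1,3) by (auto simp: partition_on_def)
  then have "finite C" using assms(2) by (metis finite_subset)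
  then show "Min C \<in> C" using C(2) by (rule Min_in)
  then show "Min C \<in> A" using C(1) by blast
qed

lemma partition_on_eq:
  assumes "partition_on A \<pi>" "C \<in> \<pi>" "D \<in> \<pi>" "x \<in> C" "x \<in> D"
  shows "C = D"
  using assms by (auto simp: partition_on_def disjoint_def)

lemma Min_inj_on_partition:
  assumes "partition_on A \<pi>" "finite A"
  shows "inj_on Min \<pi>"
proof (rule inj_onI)
  fix C D assume *: "C \<in> \<pi>" "D \<in> \<pi>" "Min C = Min D"
  then have "Min C \<in> D" using Min_partition_mem(1)[OF assms *(2)] by simp
  then show "C = D"
    using partition_on_eq[OF assms(1) *(1,2) Min_partition_mem(1)[OF assms *(1)]] by blast
qed

lemma is_representative_iff:
  assumes "partition_on A \<pi>" "finite A"
  shows "is_representative \<pi> v \<longleftrightarrow> v \<in> Min ` \<pi>"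
  using Min_partition_mem[OF assms] unfolding is_representative_def by auto

lemma lab_inv_lab:
  assumes "labelling n lab"
  shows "c \<in> coords n \<Longrightarrow> lab (inv lab c) = c"
  using assms unfolding labelling_def
  by (simp add: bij_betw_def f_inv_into_f)

lemma inner_labelled:
  fixes a x :: "real ^ 'd::finite" and lab :: "'d \<Rightarrow> coord"
  assumes "labelling n lab"
  shows "a \<bullet> x = (\<Sum>v = 4..n. a $ inv lab (Rep v) * x $ inv lab (Rep v))
    + (\<Sum>e\<in>edges n. a $ inv lab (Edge e) * x $ inv lab (Edge e))"
proof -
  have bij: "bij_betw lab UNIV (coords n)" using assms by (simp add: labelling_def)
  have "a \<bullet> x = (\<Sum>d\<in>UNIV. a $ d * x $ d)"
    by (simp add: inner_vec_def)
  also have "\<dots> = (\<Sum>c\<in>coords n. a $ inv lab c * x $ inv lab c)"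
    by (rule sum.reindex_bij_betw[OF bij_betw_inv_into[OF bij], symmetric])
  also have "\<dots> = (\<Sum>c\<in>Rep ` {4..n}. a $ inv lab c * x $ inv lab c)
      + (\<Sum>c\<in>Edge ` edges n. a $ inv lab c * x $ inv lab c)"
    unfolding coords_def by (rule sum.union_disjoint) (auto simp: edges_eq)
  also have "(\<Sum>c\<in>Rep ` {4..n}. a $ inv lab c * x $ inv lab c)
      = (\<Sum>v = 4..n. a $ inv lab (Rep v) * x $ inv lab (Rep v))"
    by (subst sum.reindex) (auto simp: inj_on_def)
  also have "(\<Sum>c\<in>Edge ` edges n. a $ inv lab c * x $ inv lab c)
      = (\<Sum>e\<in>edges n. a $ inv lab (Edge e) * x $ inv lab (Edge e))"
    by (subst sum.reindex) (auto simp: inj_on_def)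
  finally show ?thesis .
qed

lemma rep_var_char_vec:
  assumes "labelling n lab" "4 \<le> v" "v \<le> n"
  shows "rep_var lab (char_vec lab \<pi>) v = of_bool (is_representative \<pi> v)"
  using lab_inv_lab[OF assms(1), of "Rep v"] assms(2,3)
  by (simp add: rep_var_def char_vec_def coords_def)

lemma edge_var_char_vec:
  assumes "labelling n lab" "i \<in> verts n" "j \<in> verts n" "i \<noteq> j"
  shows "edge_var lab (char_vec lab \<pi>) i j = of_bool (\<exists>C\<in>\<pi>. {i, j} \<subseteq> C)"
proof -
  have "Edge {i, j} \<in> coords n" using assms(2-4) by (auto simp: coords_def edges_def)
  from lab_inv_lab[OF assms(1) this] show ?thesis
    by (simp add: edge_var_def char_vec_def)
qed

lemma inner_char_vec:
  fixes a :: "real ^ 'd::finite" and lab :: "'d \<Rightarrow> coord"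
  assumes lab: "labelling n lab" and \<pi>: "partition_on (verts n) \<pi>"
  shows "a \<bullet> char_vec lab \<pi> = (\<Sum>C\<in>\<pi>. block_sum
    (\<lambda>v. if 4 \<le> v then a $ inv lab (Rep v) else 0) (\<lambda>e. a $ inv lab (Edge e)) C)"
proof -
  let ?b = "\<lambda>v. if 4 \<le> v then a $ inv lab (Rep v) else 0"
  let ?a = "\<lambda>e. a $ inv lab (Edge e)"
  have fin: "finite \<pi>" using finite_elements[OF finite_verts \<pi>] .
  have sub: "Min ` \<pi> \<subseteq> verts n" using Min_partition_mem[OF \<pi>] by auto
  have rep: "(\<Sum>v = 4..n. a $ inv lab (Rep v) * char_vec lab \<pi> $ inv lab (Rep v))
      = (\<Sum>C\<in>\<pi>. ?b (Min C))"
  proof -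
    have "(\<Sum>v = 4..n. a $ inv lab (Rep v) * char_vec lab \<pi> $ inv lab (Rep v))
        = (\<Sum>v = 4..n. if v \<in> Min ` \<pi> then ?b v else 0)"
      using rep_var_char_vec[OF lab, unfolded rep_var_def]
      by (intro sum.cong) (auto simp: is_representative_iff[OF \<pi>])
    \<comment> \<open>The vertices 1, 2, 3 enter the sum for free, because \<open>?b\<close> is 0
      there.\<close>
    also have "\<dots> = (\<Sum>v\<in>verts n. if v \<in> Min ` \<pi> then ?b v else 0)"
      by (rule sum.mono_neutral_left) (auto simp: verts_def)
    also have "\<dots> = (\<Sum>v\<in>Min ` \<pi>. ?b v)"
      using sub by (subst sum.inter_restrict[symmetric]) (auto intro!: sum.cong)
    also have "\<dots> = (\<Sum>C\<in>\<pi>. ?b (Min C))"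
      by (subst sum.reindex[OF Min_inj_on_partition[OF \<pi>]]) auto
    finally show ?thesis .
  qed
  have edge: "(\<Sum>e\<in>edges n. ?a e * char_vec lab \<pi> $ inv lab (Edge e))
      = (\<Sum>C\<in>\<pi>. pair_sum ?a C)"
  proof -
    have "(\<Sum>e\<in>edges n. ?a e * char_vec lab \<pi> $ inv lab (Edge e))
        = (\<Sum>e\<in>edges n. if \<exists>C\<in>\<pi>. e \<subseteq> C then ?a e else 0)"
      using lab_inv_lab[OF lab] by (intro sum.cong) (auto simp: char_vec_def coords_def)
    also have "\<dots> = (\<Sum>e\<in>{e \<in> edges n. \<exists>C\<in>\<pi>. e \<subseteq> C}. ?a e)"
      by (subst sum.inter_filter) (auto simp: edges_eq)
    also have "{e \<in> edges n. \<exists>C\<in>\<pi>. e \<subseteq> C} = (\<Union>C\<in>\<pi>. {e. e \<subseteq> C \<and> card e = 2})"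
      using \<pi> unfolding edges_eq partition_on_def by blast
    also have "(\<Sum>e\<in>\<dots>. ?a e) = (\<Sum>C\<in>\<pi>. pair_sum ?a C)"
      unfolding pair_sum_def
    proof (rule sum.UNION_disjoint)
      show "finite \<pi>" by fact
      show "\<forall>C\<in>\<pi>. finite {e. e \<subseteq> C \<and> card e = 2}"
      proof
        fix C assume "C \<in> \<pi>"
        then have "C \<subseteq> verts n" using \<pi> by (auto simp: partition_on_def)
        then have "finite C" by (rule finite_subset) simp
        then show "finite {e. e \<subseteq> C \<and> card e = 2}" by simp
      qed
      show "\<forall>C\<in>\<pi>. \<forall>D\<in>\<pi>. C \<noteq> D \<longrightarrow>
          {e. e \<subseteq> C \<and> card e = 2} \<inter> {e. e \<subseteq> D \<and> card e = 2} = {}"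
      proof (intro ballI impI)
        fix C D assume "C \<in> \<pi>" "D \<in> \<pi>" "C \<noteq> D"
        then have "C \<inter> D = {}" using partition_on_eq[OF \<pi>] by blast
        then show "{e. e \<subseteq> C \<and> card e = 2} \<inter> {e. e \<subseteq> D \<and> card e = 2} = {}"
          by (auto simp: card_2_iff)
      qed
    qed
    finally show ?thesis .
  qed
  show ?thesis
    unfolding inner_labelled[OF lab] rep edge block_sum_def by (simp add: sum.distrib)
qed

section \<open>The value of the inequality at a characteristic vector, and tight partitions\<close>

definition tight :: "nat \<Rightarrow> nat set \<Rightarrow> bool" where
  "tight u C \<longleftrightarrow> (u \<in> C \<longrightarrow> card (C \<inter> {..<u}) \<le> 1)"

text \<open>With m the number of elements of \<open>C\<close> below \<open>u\<close>, the edge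
  variables count m, and \<open>u\<close> is a representative exactly when m = 0. The value is thus
  the maximum of 1 and m, which yields both validity and the criterion for equality.\<close>

lemma inequality_at_char_vec:
  fixes lab :: "'d::finite \<Rightarrow> coord"
  assumes lab: "labelling n lab" and \<pi>: "partition_on (verts n) \<pi>"
    and u: "4 \<le> u" "u \<le> n" and C: "C \<in> \<pi>" "u \<in> C"
  shows "rep_var lab (char_vec lab \<pi>) u + (\<Sum>i=1..u - 1. edge_var lab (char_vec lab \<pi>) i u)
    = of_bool (C \<inter> {..<u} = {}) + real (card (C \<inter> {..<u}))"
proof -
  have CV: "C \<subseteq> verts n" using \<pi> C by (auto simp: partition_on_def)
  then have finC: "finite C" by (rule finite_subset) simp
  have uniq: "D = C" if "D \<in> \<pi>" "u \<in> D" for D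
    using partition_on_eq[OF \<pi> that(1) C(1) that(2) C(2)] .
  have "is_representative \<pi> u \<longleftrightarrow> u = Min C"
    unfolding is_representative_def using uniq C by blast
  also have "\<dots> \<longleftrightarrow> C \<inter> {..<u} = {}"
  proof
    assume "u = Min C"
    then have "u \<le> x" if "x \<in> C" for x using Min_le[OF finC that] by simp
    then show "C \<inter> {..<u} = {}" by force
  next
    assume "C \<inter> {..<u} = {}"
    then have "\<forall>x\<in>C. u \<le> x" by (force simp: not_less[symmetric])
    then show "u = Min C" using Min_eqI[OF finC, of u] C(2) by blast
  qed
  finally have rep: "rep_var lab (char_vec lab \<pi>) u = of_bool (C \<inter> {..<u} = {})"
    using rep_var_char_vec[OF lab u] by simp
  have "(\<Sum>i=1..u - 1. edge_var lab (char_vec lab \<pi>) i u) = (\<Sum>i=1..u - 1. of_bool (i \<in> C))"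
  proof (rule sum.cong)
    fix i assume i: "i \<in> {1..u - 1}"
    then have "edge_var lab (char_vec lab \<pi>) i u = of_bool (\<exists>C\<in>\<pi>. {i, u} \<subseteq> C)"
      using u by (intro edge_var_char_vec[OF lab]) (auto simp: verts_def)
    also have "(\<exists>C\<in>\<pi>. {i, u} \<subseteq> C) \<longleftrightarrow> i \<in> C" using uniq C by blast
    finally show "edge_var lab (char_vec lab \<pi>) i u = of_bool (i \<in> C)" .
  qed simp
  also have "\<dots> = real (card ({1..u - 1} \<inter> C))"
    by (simp add: of_bool_def sum.If_cases)
  also have "{1..u - 1} \<inter> C = C \<inter> {..<u}"
    using CV u by (auto simp: verts_def)
  finally show ?thesis using rep by simp
qed

text \<open>Induction on the set: a new element becomes a block of its own, unless a single block is
  wanted. This supplies the blocks that complete small configurations to K-partitions.\<close>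

lemma partition_with_card:
  assumes "finite R" "1 \<le> k" "k \<le> card R"
  obtains \<rho> where "partition_on R \<rho>" "card \<rho> = k"
proof -
  have "\<exists>\<rho>. partition_on R \<rho> \<and> card \<rho> = k"
    using assms
  proof (induction R arbitrary: k rule: finite_induct)
    case empty
    then show ?case by simp
  next
    case (insert x R)
    show ?case
    proof (cases "k = 1")
      case True
      then show ?thesis
        by (intro exI[of _ "{insert x R}"]) (simp add: partition_on_space)
    next
      case False
      then obtain \<rho> where \<rho>: "partition_on R \<rho>" "card \<rho> = k - 1"
        using insert.IH[of "k - 1"] insert.prems insert.hyps by force
      have "partition_on (insert x R) (insert {x} \<rho>)"
        using \<rho>(1) insert.hyps
        by (auto simp: partition_on_def disjoint_def)
      moreover have "{x} \<notin> \<rho>" "finite \<rho>"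
        using \<rho>(1) insert.hyps by (auto simp: partition_on_def intro: finite_UnionD)
      ultimately show ?thesis
        using \<rho>(2) insert.prems by (intro exI[of _ "insert {x} \<rho>"]) simp
    qed
  qed
  then show ?thesis using that by blast
qed

section \<open>Functionals that vanish on all tight partitions\<close>

lemma tight_singleton [simp]: "tight u {v}"
  by (simp add: tight_def)

text \<open>Here \<open>b\<close> and \<open>a\<close> are the representative and edge coefficients
  of a vector orthogonal to all tight characteristic vectors. The assumption on \<open>b\<close>
  below 4 reflects the missing coordinates of 1, 2, 3. The aim is \<open>b_vanishes\<close> and
  \<open>a_vanishes\<close>.\<close>

locale tight_annihilator =
  fixes n K u :: nat and b :: "nat \<Rightarrow> real" and a :: "nat set \<Rightarrow> real"
  assumes K: "3 \<le> K" "K + 2 \<le> n" and u: "4 \<le> u" "u \<le> n"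
    and b_small: "v < 4 \<Longrightarrow> b v = 0"
    and annihilates: "\<lbrakk>k_partition n K \<pi>; \<forall>C\<in>\<pi>. tight u C\<rbrakk> \<Longrightarrow> (\<Sum>C\<in>\<pi>. block_sum b a C) = 0"
begin

text \<open>A frame is the part of a tight partition that stays fixed while \<open>S\<close> is
  split into two blocks in various ways.\<close>

definition frame :: "nat set \<Rightarrow> nat set set \<Rightarrow> bool" where
  "frame S \<rho> \<longleftrightarrow> S \<subseteq> verts n \<and> partition_on (verts n - S) \<rho> \<and> card \<rho> = K - 2
    \<and> (\<forall>C\<in>\<rho>. tight u C)"

lemma frame_k_partition:
  assumes "frame S \<rho>" "X \<union> Y = S" "X \<inter> Y = {}" "X \<noteq> {}" "Y \<noteq> {}"
  shows "k_partition n K (insert X (insert Y \<rho>))"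
proof -
  have \<rho>: "partition_on (verts n - S) \<rho>" "card \<rho> = K - 2" "S \<subseteq> verts n"
    using assms(1) by (auto simp: frame_def)
  have fin: "finite \<rho>" using finite_elements[OF _ \<rho>(1)] by simp
  have notin: "X \<notin> \<rho>" "Y \<notin> \<rho>" "X \<noteq> Y"
    using \<rho>(1) assms unfolding partition_on_def by blast+
  have "partition_on (verts n) (insert X (insert Y \<rho>))"
  proof -
    have U: "\<Union>\<rho> = verts n - S" using \<rho>(1) by (simp add: partition_on_def)
    have "verts n - X - Y = verts n - S" "disjnt X (\<Union>(insert Y \<rho>))" "disjnt Y (\<Union>\<rho>)"
      using assms(2,3) U by (auto simp: disjnt_def)
    then show ?thesis
      using \<rho>(1,3) assms(2-5) by (auto simp: partition_on_insert)
  qed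
  then show ?thesis
    using \<rho>(2) fin notin K by (simp add: k_partition_def)
qed

text \<open>The right-hand side depends on the frame only, so any two tight splittings of
  \<open>S\<close> can be compared.\<close>

lemma two_blocks:
  assumes "frame S \<rho>" "X \<union> Y = S" "X \<inter> Y = {}" "X \<noteq> {}" "Y \<noteq> {}" "tight u X" "tight u Y"
  shows "block_sum b a X + block_sum b a Y = - (\<Sum>C\<in>\<rho>. block_sum b a C)"
proof -
  have \<rho>: "partition_on (verts n - S) \<rho>" "\<forall>C\<in>\<rho>. tight u C"
    using assms(1) by (auto simp: frame_def)
  have fin: "finite \<rho>" using finite_elements[OF _ \<rho>(1)] by simp
  have "X \<notin> \<rho>" "Y \<notin> \<rho>" "X \<noteq> Y"
    using \<rho>(1) assms(2-5) unfolding partition_on_def by blast+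
  then show ?thesis
    using annihilates[OF frame_k_partition[OF assms(1-5)]] \<rho>(2) assms(6,7) fin by auto
qed

text \<open>The edge sums from \<open>v\<close> or \<open>w\<close> to \<open>A\<close> or
  \<open>B\<close> each occur once with either sign and cancel. The pair \<open>{v, w}\<close>
  shares a block in two of the four distributions, both counted positively.\<close>

lemma second_difference:
  assumes "frame S \<rho>" "insert v (insert w (A \<union> B)) = S"
    and "A \<inter> B = {}" "A \<noteq> {}" "B \<noteq> {}" "v \<notin> A \<union> B" "w \<notin> A \<union> B" "v \<noteq> w"
    and "\<And>C D. C \<in> {A, B} \<Longrightarrow> D \<subseteq> {v, w} \<Longrightarrow> tight u (C \<union> D)"
  shows "2 * a {v, w} + b (min (min v w) (Min A)) + b (Min B)
    - b (min v (Min A)) - b (min w (Min B))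
    - b (min w (Min A)) - b (min v (Min B))
    + b (Min A) + b (min (min v w) (Min B)) = 0"
proof -
  have "finite S" using assms(1) by (auto simp: frame_def intro: finite_subset)
  then have fin: "finite A" "finite B" using assms(2) by auto
  have t: "tight u C" "tight u (insert v C)" "tight u (insert w C)"
      "tight u (insert v (insert w C))" if "C \<in> {A, B}" for C
    using assms(9)[OF that, of "{}"] assms(9)[OF that, of "{v}"]
      assms(9)[OF that, of "{w}"] assms(9)[OF that, of "{v, w}"]
    by (simp_all add: Un_commute)
  have vw: "insert v (insert w A) \<inter> B = {}" "insert v A \<inter> insert w B = {}"
    "insert w A \<inter> insert v B = {}" "A \<inter> insert v (insert w B) = {}"
    using assms by auto
  have un: "insert v (insert w A) \<union> B = S" "insert v A \<union> insert w B = S"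
    "insert w A \<union> insert v B = S" "A \<union> insert v (insert w B) = S"
    using assms by auto
  note tb = two_blocks[OF assms(1)]
  \<comment> \<open>All four splittings have the same value, and their signs add up to 0.\<close>
  have eq: "block_sum b a (insert v (insert w A)) + block_sum b a B
      - (block_sum b a (insert v A) + block_sum b a (insert w B))
      - (block_sum b a (insert w A) + block_sum b a (insert v B))
      + (block_sum b a A + block_sum b a (insert v (insert w B))) = 0"
    using tb[OF un(1) vw(1)] tb[OF un(2) vw(2)] tb[OF un(3) vw(3)] tb[OF un(4) vw(4)]
      t[of A] t[of B] assms(4,5) by simp
  have ins: "block_sum b a (insert v (insert w C)) = block_sum b a C + a {v, w}
      + (\<Sum>j\<in>C. a {v, j}) + (\<Sum>j\<in>C. a {w, j}) + b (min (min v w) (Min C)) - b (Min C)"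
    "block_sum b a (insert v C) = block_sum b a C
      + (\<Sum>j\<in>C. a {v, j}) + b (min v (Min C)) - b (Min C)"
    "block_sum b a (insert w C) = block_sum b a C
      + (\<Sum>j\<in>C. a {w, j}) + b (min w (Min C)) - b (Min C)"
    if "finite C" "C \<noteq> {}" "v \<notin> C" "w \<notin> C" for C
  proof -
    show "block_sum b a (insert v C) = block_sum b a C
        + (\<Sum>j\<in>C. a {v, j}) + b (min v (Min C)) - b (Min C)"
      using that by (simp add: block_sum_insert)
    show w: "block_sum b a (insert w C) = block_sum b a C
        + (\<Sum>j\<in>C. a {w, j}) + b (min w (Min C)) - b (Min C)"
      using that by (simp add: block_sum_insert)
    have "block_sum b a (insert v (insert w C)) = block_sum b a (insert w C)
        + (\<Sum>j\<in>insert w C. a {v, j}) + b (min v (Min (insert w C))) - b (Min (insert w C))"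
      using that \<open>v \<noteq> w\<close> by (intro block_sum_insert) auto
    moreover have m: "Min (insert w C) = min w (Min C)"
      and s: "(\<Sum>j\<in>insert w C. a {v, j}) = a {v, w} + (\<Sum>j\<in>C. a {v, j})"
      using that by auto
    ultimately show "block_sum b a (insert v (insert w C)) = block_sum b a C + a {v, w}
        + (\<Sum>j\<in>C. a {v, j}) + (\<Sum>j\<in>C. a {w, j}) + b (min (min v w) (Min C)) - b (Min C)"
      unfolding min.assoc w m s by linarith
  qed
  have notin: "v \<notin> A" "w \<notin> A" "v \<notin> B" "w \<notin> B" using assms(6,7) by auto
  show ?thesis
    using eq ins[OF fin(1) assms(4) notin(1,2)] ins[OF fin(2) assms(5) notin(3,4)] by linarith
qed

text \<open>In the proof the block of \<open>u\<close> is the singleton \<open>{u}\<close>, so tightness imposes nothing on the other blocks.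
  The vertices in excess of those needed to reach \<open>K\<close> blocks join \<open>p\<close>.\<close>

lemma second_difference_avoiding:
  assumes "{p, q, v, w} \<subseteq> verts n - {u}" "card {p, q, v, w} = 4"
    and "\<And>i. 1 \<le> i \<Longrightarrow> i < p \<Longrightarrow> i \<in> {q, v, w}"
  shows "2 * a {v, w} + b (min (min v w) p) + b q - b (min v p) - b (min w q)
    - b (min w p) - b (min v q) + b p + b (min (min v w) q) = 0"
proof -
  have "verts n - {p, q, v, w} - {u} = verts n - insert u {p, q, v, w}" by blast
  moreover have "card (insert u {p, q, v, w}) = 5"
    using assms(1,2) by (subst card_insert_disjoint) auto
  moreover have "insert u {p, q, v, w} \<subseteq> verts n"
    using assms(1) u by (auto simp: verts_def)
  ultimately have "card (verts n - {p, q, v, w} - {u}) = n - 5"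
    by (simp add: card_Diff_subset verts_def)
  \<comment> \<open>Together with \<open>u\<close>, these K - 3 vertices form the K - 2 singleton
    blocks of the frame.\<close>
  then have "K - 3 \<le> card (verts n - {p, q, v, w} - {u})" using K by simp
  then obtain R' where R': "R' \<subseteq> verts n - {p, q, v, w} - {u}" "card R' = K - 3"
    by (metis obtain_subset_with_card_n)
  define R where "R = insert u R'"
  define A where "A = verts n - R - {q, v, w}"
  have finR: "finite R'" using R'(1) by (rule finite_subset) simp
  have cardR: "card R = K - 2"
    using R' K finR by (subst R_def, subst card_insert_disjoint) auto
  have R: "R \<subseteq> verts n" "R \<inter> {p, q, v, w} = {}" "u \<in> R"
    using R'(1) assms(1) u by (auto simp: R_def verts_def)
  have dist: "p \<noteq> q" "p \<noteq> v" "p \<noteq> w" "q \<noteq> v" "q \<noteq> w" "v \<noteq> w"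
    using assms(2) by (auto simp: card_insert_if split: if_splits)
  have "frame (verts n - R) ((\<lambda>x. {x}) ` R)"
    unfolding frame_def using R cardR
    by (auto simp: partition_on_singletons double_diff card_image)
  \<comment> \<open>By the third assumption every vertex below \<open>p\<close> is one of
    \<open>q\<close>, \<open>v\<close>, \<open>w\<close>, none of which is in
    \<open>A\<close>.\<close>
  moreover have "Min A = p"
  proof (rule Min_eqI)
    show "p \<in> A" using assms(1) R dist by (auto simp: A_def)
    show "finite A" by (simp add: A_def)
    fix i assume "i \<in> A"
    then show "p \<le> i" using assms(3)[of i] by (force simp: A_def verts_def)
  qed
  moreover have "insert v (insert w (A \<union> {q})) = verts n - R"
    using R assms(1) by (auto simp: A_def)
  moreover have "p \<in> A" using assms(1) R dist by (auto simp: A_def)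
  moreover have "tight u (C \<union> D)" if "C \<in> {A, {q}}" "D \<subseteq> {v, w}" for C D
  proof -
    have "u \<notin> C \<union> D" using that R(3) assms(1) by (auto simp: A_def)
    then show ?thesis by (simp add: tight_def)
  qed
  moreover have "A \<inter> {q} = {}" "v \<notin> A \<union> {q}" "w \<notin> A \<union> {q}"
    using dist by (auto simp: A_def)
  ultimately show ?thesis
    using second_difference[of "verts n - R" "(\<lambda>x. {x}) ` R" v w A "{q}"] dist by auto
qed

text \<open>At least n - 4 vertices lie outside \<open>S\<close>, enough for K - 2 blocks. These are
  tight because \<open>u\<close> lies in \<open>S\<close>.\<close>

lemma frame_exists:
  assumes "u \<in> S" "S \<subseteq> verts n" "card S \<le> 4"
  obtains \<rho> where "frame S \<rho>"
proof -
  have "finite S" using assms(2) by (rule finite_subset) simp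
  then have "card (verts n - S) = n - card S"
    using assms(2) by (simp add: card_Diff_subset verts_def)
  then have "1 \<le> K - 2" "K - 2 \<le> card (verts n - S)" using assms(3) K by auto
  then obtain \<rho> where \<rho>: "partition_on (verts n - S) \<rho>" "card \<rho> = K - 2"
    by (metis partition_with_card finite_Diff finite_verts)
  have "\<forall>C\<in>\<rho>. u \<notin> C" using \<rho>(1) assms(1) by (auto simp: partition_on_def)
  then have "frame S \<rho>" using \<rho> assms(2) unfolding frame_def tight_def by blast
  then show thesis by (rule that)
qed

lemma exchange:
  assumes "X \<union> Y = X' \<union> Y'" "X \<inter> Y = {}" "X' \<inter> Y' = {}"
    and "X \<noteq> {}" "Y \<noteq> {}" "X' \<noteq> {}" "Y' \<noteq> {}"
    and "X \<union> Y \<subseteq> verts n" "u \<in> X \<union> Y" "card (X \<union> Y) \<le> 4"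
    and "tight u X" "tight u Y" "tight u X'" "tight u Y'"
  shows "block_sum b a X + block_sum b a Y = block_sum b a X' + block_sum b a Y'"
proof -
  obtain \<rho> where \<rho>: "frame (X \<union> Y) \<rho>" using frame_exists assms(8-10) by blast
  show ?thesis
    using two_blocks[OF \<rho>, of X Y] two_blocks[OF \<rho>, of X' Y'] assms by simp
qed

lemma block_sum_singleton: "block_sum b a {v} = b v"
  by (simp add: block_sum_def)

lemma block_sum_pair:
  assumes "i < j"
  shows "block_sum b a {i, j} = b i + a {i, j}"
  using assms by (simp add: block_sum_def pair_sum_insert)

lemma tight_pair [simp]: "tight v {i, v}" "tight v {v, i}"
proof -
  have "card ({i} \<inter> {..<v}) \<le> 1" using card_mono[of "{i}" "{i} \<inter> {..<v}"] by auto
  then show "tight v {i, v}" "tight v {v, i}" by (auto simp: tight_def Int_insert_left)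
qed

text \<open>This is the second difference of \<open>u\<close> and \<open>j\<close> over the blocks
  \<open>{1}\<close> and \<open>{2}\<close>. Every minimum is 1 or 2, so no representative term
  remains.\<close>

lemma edge_above_u:
  assumes "u < j" "j \<le> n"
  shows "a {u, j} = 0"
proof -
  have S: "u \<in> {u, j, 1, 2}" "{u, j, 1, 2} \<subseteq> verts n" "card {u, j, 1, 2} \<le> 4"
    using assms u by (auto simp: verts_def card_insert_if)
  obtain \<rho> where \<rho>: "frame {u, j, 1, 2} \<rho>" using frame_exists[OF S] .
  \<comment> \<open>Nothing in \<open>D\<close> is below \<open>u\<close>, so the single element of
    \<open>C\<close> is the only one that can be.\<close>
  have t: "tight u (C \<union> D)" if "C \<in> {{1}, {2}}" "D \<subseteq> {u, j}" for C D
  proof -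
    have "(C \<union> D) \<inter> {..<u} \<subseteq> C" "card C = 1" "finite C" using that assms by auto
    then show ?thesis unfolding tight_def by (metis card_mono)
  qed
  have "{u, j, 1, 2} = insert u (insert j ({1} \<union> {2}))" by auto
  from second_difference[OF \<rho> this[symmetric] _ _ _ _ _ _ t]
  show ?thesis using assms u b_small by simp
qed

text \<open>Moving \<open>u\<close> from the block of \<open>i\<close> to that of \<open>j\<close>
  changes no representative.\<close>

lemma edge_below_u_const:
  assumes "1 \<le> i" "i < u" "1 \<le> j" "j < u"
  shows "a {i, u} = a {j, u}"
proof (cases "i = j")
  case False
  then have "block_sum b a {i, u} + block_sum b a {j} = block_sum b a {i} + block_sum b a {j, u}"
    using assms u by (intro exchange) (auto simp: verts_def card_insert_if)
  then show ?thesis using assms by (simp add: block_sum_pair block_sum_singleton)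
qed simp

text \<open>Vertex 2 moves from the block of 1 to that of \<open>u\<close>, which then ceases to be
  a representative.\<close>

lemma edge_below_u_first: "a {1, u} = b u + a {1, 2}"
proof -
  have "block_sum b a {u} + block_sum b a {1, 2} = block_sum b a {2, u} + block_sum b a {1}"
    using u by (intro exchange) (auto simp: verts_def card_insert_if tight_def)
  then show ?thesis using edge_below_u_const[of 1 2] u b_small
    by (simp add: block_sum_pair block_sum_singleton)
qed

text \<open>Vertex 1 moves from the block of \<open>q\<close> to that of \<open>u\<close>:
  \<open>q\<close> becomes a representative and \<open>u\<close> ceases to be one.\<close>

lemma edge_below_u_second:
  assumes "4 \<le> q" "q \<le> n" "q \<noteq> u"
  shows "b u + a {1, q} = a {1, u} + b q"
proof -
  have "block_sum b a {u} + block_sum b a {1, q} = block_sum b a {1, u} + block_sum b a {q}"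
    using u assms by (intro exchange) (auto simp: verts_def card_insert_if tight_def)
  then show ?thesis using u b_small assms
    by (simp add: block_sum_pair block_sum_singleton)
qed

text \<open>In each case \<open>p\<close> and \<open>q\<close> are chosen from 1, 2, 3 and different
  from \<open>v\<close>. Then every minimum in the second difference is at most 3, and all
  representative terms vanish.\<close>

lemma edge_avoiding_u:
  assumes "1 \<le> v" "v < w" "4 \<le> w" "w \<le> n" "v \<noteq> u" "w \<noteq> u"
  shows "a {v, w} = 0"
proof -
  consider "v = 1" | "v = 2" | "3 \<le> v" using assms(1) by linarith
  then show ?thesis
  proof cases
    case 1
    have "{2, 3, v, w} \<subseteq> verts n - {u}" "card {2, 3, v, w} = 4"
      "\<And>i. 1 \<le> i \<Longrightarrow> i < 2 \<Longrightarrow> i \<in> {3, v, w}"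
      using assms u 1 by (auto simp: verts_def)
    from second_difference_avoiding[OF this] show ?thesis
      using assms b_small 1 by (simp add: min_def)
  next
    case 2
    have "{1, 3, v, w} \<subseteq> verts n - {u}" "card {1, 3, v, w} = 4"
      "\<And>i. 1 \<le> i \<Longrightarrow> i < 1 \<Longrightarrow> i \<in> {3, v, w}"
      using assms u 2 by (auto simp: verts_def)
    from second_difference_avoiding[OF this] show ?thesis
      using assms b_small 2 by (simp add: min_def)
  next
    case 3
    have "{1, 2, v, w} \<subseteq> verts n - {u}" "card {1, 2, v, w} = 4"
      "\<And>i. 1 \<le> i \<Longrightarrow> i < 1 \<Longrightarrow> i \<in> {2, v, w}"
      using assms u 3 by (auto simp: verts_def)
    from second_difference_avoiding[OF this] show ?thesis
      using assms b_small 3 by (simp add: min_def)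
  qed
qed

text \<open>When \<open>p\<close>, \<open>v\<close>, \<open>w\<close> are 1, 2, 3 in some order,
  \<open>q\<close> represents its block only while alone there. So \<open>b q\<close> is the one
  representative term that survives.\<close>

lemma edge_initial:
  assumes "4 \<le> q" "q \<le> n" "q \<noteq> u"
  shows "2 * a {1, 2} = - b q" "2 * a {1, 3} = - b q" "2 * a {2, 3} = - b q"
proof -
  have "{3, q, 1, 2} \<subseteq> verts n - {u}" "card {3, q, 1, 2} = 4"
    "\<And>i. 1 \<le> i \<Longrightarrow> i < 3 \<Longrightarrow> i \<in> {q, 1, 2}"
    using assms u by (auto simp: verts_def)
  from second_difference_avoiding[OF this] show "2 * a {1, 2} = - b q"
    using assms b_small by (simp add: min_def)
  have "{2, q, 1, 3} \<subseteq> verts n - {u}" "card {2, q, 1, 3} = 4"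
    "\<And>i. 1 \<le> i \<Longrightarrow> i < 2 \<Longrightarrow> i \<in> {q, 1, 3}"
    using assms u by (auto simp: verts_def)
  from second_difference_avoiding[OF this] show "2 * a {1, 3} = - b q"
    using assms b_small by (simp add: min_def)
  have "{1, q, 2, 3} \<subseteq> verts n - {u}" "card {1, q, 2, 3} = 4"
    "\<And>i. 1 \<le> i \<Longrightarrow> i < 1 \<Longrightarrow> i \<in> {q, 2, 3}"
    using assms u by (auto simp: verts_def)
  from second_difference_avoiding[OF this] show "2 * a {2, 3} = - b q"
    using assms b_small by (simp add: min_def)
qed

text \<open>As \<open>a {1, q} = 0\<close>, eliminating \<open>a {1, u}\<close> from its two
  formulas gives \<open>a {1, 2} = - b q\<close>. But \<open>edge_initial\<close> gives half of
  that, so both are 0.\<close>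

lemma b_eq_0:
  assumes "q \<le> n" "q \<noteq> u"
  shows "b q = 0"
proof (cases "4 \<le> q")
  case True
  then show ?thesis
    using edge_below_u_first edge_below_u_second[OF True assms] edge_initial(1)[OF True assms]
      edge_avoiding_u[of 1 q] u assms by simp
qed (simp add: b_small)

lemma edge_initial_eq_0: "a {1, 2} = 0" "a {1, 3} = 0" "a {2, 3} = 0"
proof -
  \<comment> \<open>The bounds on K give n at least 5, so 4 or 5 is a vertex other than
    \<open>u\<close>.\<close>
  obtain q where q: "4 \<le> q" "q \<le> n" "q \<noteq> u"
    using that[of 4] that[of 5] K by fastforce
  show "a {1, 2} = 0" "a {1, 3} = 0" "a {2, 3} = 0"
    using edge_initial[OF q] b_eq_0[OF q(2,3)] by simp_all
qed

lemma edge_eq_0: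
  assumes "1 \<le> v" "v < w" "w \<le> n" "v \<noteq> u" "w \<noteq> u"
  shows "a {v, w} = 0"
proof (cases "4 \<le> w")
  case True
  then show ?thesis using edge_avoiding_u assms by simp
next
  case False
  then consider "v = 1" "w = 2" | "v = 1" "w = 3" | "v = 2" "w = 3" using assms by linarith
  then show ?thesis using edge_initial_eq_0 by cases simp_all
qed

lemma edge_below_u:
  assumes "1 \<le> i" "i < u"
  shows "a {i, u} = b u"
  using edge_below_u_const[of i 1] edge_below_u_first edge_initial_eq_0(1) assms u by simp

lemma block_sum_avoiding_u:
  assumes "C \<subseteq> verts n" "C \<noteq> {}" "u \<notin> C"
  shows "block_sum b a C = 0"
proof -
  have "finite C" using assms(1) by (rule finite_subset) simp
  then have "Min C \<in> C" using assms(2) by (rule Min_in)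
  then have "Min C \<le> n" "Min C \<noteq> u" using assms(1,3) by (auto simp: verts_def)
  then have "b (Min C) = 0" by (rule b_eq_0)
  moreover have "a e = 0" if e: "e \<subseteq> C" "card e = 2" for e
  proof -
    obtain v w where vw: "e = {v, w}" "v < w"
      using e(2) by (metis card_2_iff insert_commute linorder_neqE_nat)
    have "v \<in> verts n" "w \<in> verts n" "v \<noteq> u" "w \<noteq> u" using e(1) vw(1) assms by auto
    then show ?thesis using edge_eq_0 vw by (auto simp: verts_def)
  qed
  ultimately show ?thesis by (simp add: block_sum_def pair_sum_def)
qed

text \<open>In a tight partition with the blocks \<open>{1}\<close> and \<open>{u}\<close>, all
  blocks other than \<open>{u}\<close> contribute 0.\<close>

lemma b_u_eq_0: "b u = 0"
proof -
  have S: "u \<in> {1, u}" "{1, u} \<subseteq> verts n" "card {1, u} \<le> 4"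
    using u by (auto simp: verts_def card_insert_if)
  obtain \<rho> where \<rho>: "frame {1, u} \<rho>" using frame_exists[OF S] .
  have "block_sum b a C = 0" if "C \<in> \<rho>" for C
  proof (rule block_sum_avoiding_u)
    have "C \<subseteq> verts n - {1, u}" "C \<noteq> {}"
      using \<rho> that by (auto simp: frame_def partition_on_def)
    then show "C \<subseteq> verts n" "C \<noteq> {}" "u \<notin> C" by auto
  qed
  then have "block_sum b a {1} + block_sum b a {u} = 0"
    using two_blocks[OF \<rho>, of "{1}" "{u}"] u by (simp add: insert_commute)
  then show ?thesis using b_small[of 1] by (simp add: block_sum_singleton)
qed

lemma b_vanishes: "v \<le> n \<Longrightarrow> b v = 0"
  using b_eq_0 b_u_eq_0 by metis

lemma a_vanishes:
  assumes "e \<in> edges n"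
  shows "a e = 0"
proof -
  obtain v w where vw: "e = {v, w}" "v < w" "1 \<le> v" "w \<le> n"
    using assms unfolding edges_def verts_def
    by (auto, metis insert_commute linorder_neqE_nat)
  then consider "v = u" | "w = u" | "v \<noteq> u" "w \<noteq> u" by blast
  then show ?thesis
    by cases (use vw edge_above_u edge_below_u b_u_eq_0 edge_eq_0 in auto)
qed

end

section \<open>Equations satisfied by all K-partitions when K is too large or too small\<close>

text \<open>The other K - 1 blocks take up at least K - 1 vertices, which leaves at most n - K + 1
  for \<open>C\<close>.\<close>

lemma card_block_le_2:
  assumes "k_partition n K \<pi>" "n \<le> K + 1" "C \<in> \<pi>"
  shows "card C \<le> 2"
proof -
  have \<pi>: "partition_on (verts n) \<pi>" "card \<pi> = K" using assms(1) by (auto simp: k_partition_def)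
  have fin: "finite \<pi>" using finite_elements[OF finite_verts \<pi>(1)] .
  have finC: "finite D" "D \<noteq> {}" if "D \<in> \<pi>" for D
  proof -
    have "D \<subseteq> verts n" using \<pi>(1) that by (auto simp: partition_on_def)
    then show "finite D" by (rule finite_subset) simp
    show "D \<noteq> {}" using \<pi>(1) that by (auto simp: partition_on_def)
  qed
  have "n = card (\<Union>\<pi>)" using \<pi>(1) by (simp add: partition_on_def verts_def)
  also have "\<dots> = (\<Sum>D\<in>\<pi>. card D)"
    using \<pi>(1) finC
    by (intro card_Union_disjoint) (auto simp: partition_on_def disjoint_def pairwise_def disjnt_def)
  also have "\<dots> = card C + (\<Sum>D\<in>\<pi> - {C}. card D)"
    using fin assms(3) by (rule sum.remove)
  finally have "n = card C + (\<Sum>D\<in>\<pi> - {C}. card D)" .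
  moreover have "card (\<pi> - {C}) * 1 \<le> (\<Sum>D\<in>\<pi> - {C}. card D)"
    using finC sum_mono[of "\<pi> - {C}" "\<lambda>_. 1" card] by (simp add: Suc_le_eq card_gt_0_iff)
  moreover have "card (\<pi> - {C}) = K - 1" "1 \<le> K"
    using fin assms(3) \<pi>(2) by (auto simp: card_gt_0_iff Suc_le_eq)
  ultimately show ?thesis using assms(2) by linarith
qed

lemma tight_if_card_le_2:
  assumes "finite C" "card C \<le> 2"
  shows "tight u C"
  unfolding tight_def
proof
  assume "u \<in> C"
  have "card (C \<inter> {..<u}) \<le> card (C - {u})" using assms(1) by (intro card_mono) auto
  then show "card (C \<inter> {..<u}) \<le> 1" using assms \<open>u \<in> C\<close> by simp
qed

text \<open>This recovers from the edges whether 1, 2, 3 are representatives, which no coordinate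
  records.\<close>

lemma in_Min_image_partition_iff:
  assumes "partition_on (verts n) \<pi>" "v \<in> verts n"
  shows "v \<in> Min ` \<pi> \<longleftrightarrow> \<not> (\<exists>i\<in>{1..<v}. \<exists>C\<in>\<pi>. {i, v} \<subseteq> C)"
proof -
  obtain C where C: "C \<in> \<pi>" "v \<in> C" using assms by (auto simp: partition_on_def)
  have CV: "C \<subseteq> verts n" using assms(1) C by (auto simp: partition_on_def)
  then have fin: "finite C" by (rule finite_subset) simp
  have uniq: "D = C" if "D \<in> \<pi>" "v \<in> D" for D
    using partition_on_eq[OF assms(1) that(1) C(1) that(2) C(2)] .
  note M = Min_partition_mem[OF assms(1) finite_verts]
  have "v \<in> Min ` \<pi> \<longleftrightarrow> v = Min C"
    using uniq C M(1) by blast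
  also have "\<dots> \<longleftrightarrow> \<not> (\<exists>i\<in>{1..<v}. i \<in> C)"
  proof
    assume "v = Min C"
    then have "v \<le> x" if "x \<in> C" for x using Min_le[OF fin that] by simp
    then show "\<not> (\<exists>i\<in>{1..<v}. i \<in> C)" by force
  next
    assume *: "\<not> (\<exists>i\<in>{1..<v}. i \<in> C)"
    have "Min C \<in> C" "1 \<le> Min C" using M[OF C(1)] by (auto simp: verts_def)
    with * have "\<not> Min C < v" by auto
    then show "v = Min C" using Min_le[OF fin C(2)] by simp
  qed
  also have "\<dots> \<longleftrightarrow> \<not> (\<exists>i\<in>{1..<v}. \<exists>C\<in>\<pi>. {i, v} \<subseteq> C)"
    using uniq C by blast
  finally show ?thesis .
qed

text \<open>Two of 1, 2, 3 share a block. If exactly one pair does, two of the K representatives are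
  at most 3, and the left side is 1 - 2 (K - 2). If all three do, only one is, and it is 3 - 2 (K -
  1).\<close>

lemma equation_if_at_most_two_blocks:
  fixes lab :: "'d::finite \<Rightarrow> coord"
  assumes lab: "labelling n lab" and \<pi>: "k_partition n K \<pi>" and K: "K \<le> 2" and n: "4 \<le> n"
  defines "x \<equiv> char_vec lab \<pi>"
  shows "edge_var lab x 1 2 + edge_var lab x 1 3 + edge_var lab x 2 3
    - 2 * (\<Sum>v=4..n. rep_var lab x v) = 5 - 2 * real K"
proof -
  have part: "partition_on (verts n) \<pi>" "card \<pi> = K" using \<pi> by (auto simp: k_partition_def)
  have fin: "finite \<pi>" using finite_elements[OF finite_verts part(1)] .
  define R where "R = Min ` \<pi>"
  define T where "T i j \<longleftrightarrow> (\<exists>C\<in>\<pi>. {i, j} \<subseteq> C)" for i j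
  have cardR: "card R = K"
    using card_image[OF Min_inj_on_partition[OF part(1)]] part(2) by (simp add: R_def)
  have RV: "R \<subseteq> verts n" using Min_partition_mem[OF part(1)] by (auto simp: R_def)
  have V: "1 \<in> verts n" "2 \<in> verts n" "3 \<in> verts n" using n by (auto simp: verts_def)
  have sub: "{1..<1} = ({}::nat set)" "{1..<2} = {1::nat}" "{1..<3} = {1, 2::nat}" by auto
  have mem: "1 \<in> R" "2 \<in> R \<longleftrightarrow> \<not> T 1 2" "3 \<in> R \<longleftrightarrow> \<not> T 1 3 \<and> \<not> T 2 3"
    using V by (simp_all only: R_def T_def in_Min_image_partition_iff[OF part(1)] sub) auto
  have "(\<Sum>v=4..n. rep_var lab x v) = (\<Sum>v=4..n. of_bool (v \<in> R))"
    using rep_var_char_vec[OF lab] is_representative_iff[OF part(1)]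
    by (intro sum.cong) (auto simp: x_def R_def)
  also have "\<dots> = real (card ({4..n} \<inter> R))" by (simp add: of_bool_def sum.If_cases)
  finally have rep: "(\<Sum>v=4..n. rep_var lab x v) = real (card ({4..n} \<inter> R))" .
  have "R = ({4..n} \<inter> R) \<union> ({1, 2, 3} \<inter> R)"
    using RV by (auto simp: verts_def)
  then have "card R = card (({4..n} \<inter> R) \<union> ({1, 2, 3} \<inter> R))"
    by (rule arg_cong[where f = card])
  also have "\<dots> = card ({4..n} \<inter> R) + card ({1, 2, 3} \<inter> R)"
    by (rule card_Un_disjoint) auto
  also have "card ({1, 2, 3} \<inter> R) = of_bool (1 \<in> R) + of_bool (2 \<in> R) + of_bool (3 \<in> R)"
    by (simp add: Int_insert_left)
  finally have card: "K = card ({4..n} \<inter> R) + 1 + of_bool (\<not> T 1 2) + of_bool (\<not> T 1 3 \<and> \<not> T 2 3)"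
    using cardR mem by simp
  have edge: "edge_var lab x i j = of_bool (T i j)" if "i \<in> verts n" "j \<in> verts n" "i \<noteq> j" for i j
    using edge_var_char_vec[OF lab that] by (simp add: x_def T_def)
  have "T 1 2 \<or> T 1 3 \<or> T 2 3"
  proof (rule ccontr)
    assume none: "\<not> (T 1 2 \<or> T 1 3 \<or> T 2 3)"
    then have "{1, 2, 3} \<subseteq> R" using mem by simp
    then have "card {1, 2, 3::nat} \<le> card R" using fin by (intro card_mono) (auto simp: R_def)
    then show False using cardR K by simp
  qed
  \<comment> \<open>Sharing a block is transitive, which rules out exactly two joined pairs among 1,
    2, 3.\<close>
  moreover have "T i k" if T: "T i j" "T j k" for i j k
  proof -
    obtain C D where CD: "C \<in> \<pi>" "{i, j} \<subseteq> C" "D \<in> \<pi>" "{j, k} \<subseteq> D"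
      using T by (auto simp: T_def)
    then have "C = D" by (intro partition_on_eq[OF part(1), of C D j]) auto
    then show ?thesis using CD by (auto simp: T_def)
  qed
  from this[of 2 1 3] this[of 1 2 3] this[of 1 3 2]
  have "T 1 2 \<and> T 1 3 \<longrightarrow> T 2 3" "T 1 2 \<and> T 2 3 \<longrightarrow> T 1 3" "T 1 3 \<and> T 2 3 \<longrightarrow> T 1 2"
    by (auto simp: T_def insert_commute)
  ultimately show ?thesis
    unfolding rep card using edge V by (cases "T 1 2"; cases "T 1 3"; cases "T 2 3") simp_all
qed

section \<open>Level sets of linear functionals and affine dimension\<close>

lemma linear_level_set_convex:
  fixes f :: "'a::real_vector \<Rightarrow> real"
  assumes "linear f"
  shows "convex {x. f x = c}" "convex {x. f x \<ge> c}"
proof -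
  have "{x. f x = c} = f -` {c}" "{x. f x \<ge> c} = f -` {c..}" by auto
  then show "convex {x. f x = c}" "convex {x. f x \<ge> c}"
    using convex_linear_vimage[OF assms] by simp_all
qed

lemma aff_dim_level_set_le:
  fixes f :: "'a::euclidean_space \<Rightarrow> real"
  assumes "linear f" "\<And>x. x \<in> S \<Longrightarrow> f x = c" "c \<noteq> 0"
  shows "aff_dim S \<le> int DIM('a) - 1"
proof -
  \<comment> \<open>This vector represents \<open>f\<close> through the scalar product.\<close>
  define v where "v = adjoint f 1"
  have f: "f x = v \<bullet> x" for x
    using adjoint_works[OF assms(1), of x 1] by (simp add: v_def inner_commute)
  show ?thesis
  proof (cases "v = 0")
    case True
    then have "S = {}" using assms(2,3) f by fastforce
    then show ?thesis by simp
  next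
    case False
    have "S \<subseteq> {x. v \<bullet> x = c}" using assms(2) f by auto
    from aff_dim_subset[OF this] show ?thesis by (simp add: aff_dim_hyperplane[OF False])
  qed
qed

text \<open>The affine hull of \<open>S\<close> stays in the level set and misses 0. Adding 0 turns
  a bound on the affine dimension into a question about linear hyperplanes.\<close>

lemma aff_dim_insert_0_level_set:
  fixes f :: "'a::euclidean_space \<Rightarrow> real"
  assumes "linear f" "\<And>x. x \<in> S \<Longrightarrow> f x = c" "c \<noteq> 0"
  shows "aff_dim (insert 0 S) = aff_dim S + 1"
proof -
  have "affine {x. f x = c}"
    using assms(1) unfolding affine_def
    by (auto simp: linear_add linear_cmul simp flip: distrib_right)
  then have "affine hull S \<subseteq> {x. f x = c}" using assms(2) by (intro hull_minimal) auto
  then have "0 \<notin> affine hull S" using assms(3) linear_0[OF assms(1)] by auto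
  then show ?thesis by (simp add: aff_dim_insert)
qed

theorem theorem4p5:
  fixes n K u :: nat and lab :: "'d::finite \<Rightarrow> coord"
  assumes "labelling n lab"
    and "full_dimensional (partition_polytope n K lab)"
    and "u \<in> verts n" and "u \<ge> 4"
  shows "facet_defining (partition_polytope n K lab)
           (\<lambda>x. rep_var lab x u + (\<Sum>i=1..u - 1. edge_var lab x i u)) 1"
proof -
  note lab = assms(1)
  let ?d = "int DIM(real ^ 'd)"
  define P where "P = partition_polytope n K lab"
  define V where "V = {char_vec lab \<pi> |\<pi>. k_partition n K \<pi>}"
  define f where "f x = rep_var lab x u + (\<Sum>i=1..u - 1. edge_var lab x i u)" for x :: "real ^ 'd"
  define F where "F = {x \<in> P. f x = 1}"
  have P: "P = convex hull V" by (simp add: P_def V_def partition_polytope_def)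
  have dimP: "aff_dim P = ?d" using assms(2) by (simp add: full_dimensional_def P_def)
  have u: "4 \<le> u" "u \<le> n" using assms(3,4) by (auto simp: verts_def)
  have lin: "linear f"
    unfolding f_def rep_var_def edge_var_def linear_iff
    by (simp add: sum.distrib sum_distrib_left distrib_left)
  have f_ge: "1 \<le> f (char_vec lab \<pi>)"
    and f_eq: "f (char_vec lab \<pi>) = 1 \<longleftrightarrow> (\<forall>C\<in>\<pi>. tight u C)"
    if \<pi>: "k_partition n K \<pi>" for \<pi>
  proof -
    have part: "partition_on (verts n) \<pi>" using \<pi> by (simp add: k_partition_def)
    then obtain C where C: "C \<in> \<pi>" "u \<in> C" using assms(3) by (auto simp: partition_on_def)
    have "(\<forall>C\<in>\<pi>. tight u C) \<longleftrightarrow> card (C \<inter> {..<u}) \<le> 1"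
      using C partition_on_eq[OF part] unfolding tight_def by metis
    moreover have "f (char_vec lab \<pi>)
        = of_bool (card (C \<inter> {..<u}) = 0) + real (card (C \<inter> {..<u}))"
      using inequality_at_char_vec[OF lab part u C] by (simp add: f_def)
    ultimately show "1 \<le> f (char_vec lab \<pi>)"
      and "f (char_vec lab \<pi>) = 1 \<longleftrightarrow> (\<forall>C\<in>\<pi>. tight u C)"
      by (cases "card (C \<inter> {..<u}) = 0"; force)+
  qed
  \<comment> \<open>Such an equation on the vertices would put all of \<open>P\<close> into a proper
    affine subspace.\<close>
  have not_flat: False if "linear g" "\<And>x. x \<in> V \<Longrightarrow> g x = c" "c \<noteq> 0"
    for g :: "real ^ 'd \<Rightarrow> real" and c
  proof -
    have "P \<subseteq> {x. g x = c}"
      unfolding P using that(2) by (intro hull_minimal linear_level_set_convex that(1)) auto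
    then show False using aff_dim_level_set_le[OF that(1) _ that(3), of P] dimP by auto
  qed
  have "3 \<le> K"
  proof (rule ccontr)
    assume "\<not> 3 \<le> K"
    define g where "g x = edge_var lab x 1 2 + edge_var lab x 1 3 + edge_var lab x 2 3
      - 2 * (\<Sum>v=4..n. rep_var lab x v)" for x
    have "linear g"
      unfolding g_def rep_var_def edge_var_def linear_iff
      by (simp add: sum.distrib sum_distrib_left algebra_simps)
    moreover have "g x = 5 - 2 * real K" if "x \<in> V" for x
      using that equation_if_at_most_two_blocks[OF lab] \<open>\<not> 3 \<le> K\<close> u by (auto simp: V_def g_def)
    moreover have "5 - 2 * real K \<noteq> 0" using \<open>\<not> 3 \<le> K\<close> by simp
    ultimately show False by (rule not_flat)
  qed
  moreover have "K + 2 \<le> n"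
  proof (rule ccontr)
    assume "\<not> K + 2 \<le> n"
    have "f x = 1" if x: "x \<in> V" for x
    proof -
      obtain \<pi> where \<pi>: "k_partition n K \<pi>" "x = char_vec lab \<pi>" using x by (auto simp: V_def)
      have "tight u C" if "C \<in> \<pi>" for C
      proof (rule tight_if_card_le_2)
        have "C \<subseteq> verts n" using \<pi>(1) that by (auto simp: k_partition_def partition_on_def)
        then show "finite C" by (rule finite_subset) simp
        show "card C \<le> 2" using card_block_le_2[OF \<pi>(1) _ that] \<open>\<not> K + 2 \<le> n\<close> by simp
      qed
      then show ?thesis using f_eq \<pi> by simp
    qed
    then show False using not_flat[OF lin, of 1] by simp
  qed
  ultimately have K: "3 \<le> K" "K + 2 \<le> n" .
  have valid: "\<forall>x\<in>P. 1 \<le> f x"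
  proof -
    have "P \<subseteq> {x. f x \<ge> 1}"
      unfolding P using f_ge by (intro hull_minimal linear_level_set_convex lin) (auto simp: V_def)
    then show ?thesis by auto
  qed
  have F1: "f x = 1" if "x \<in> F" for x using that by (simp add: F_def)
  have "?d - 1 \<le> aff_dim F"
  proof (rule ccontr)
    assume "\<not> ?d - 1 \<le> aff_dim F"
    then have "aff_dim (insert 0 F) < ?d"
      using aff_dim_insert_0_level_set[OF lin F1] by simp
    then obtain a r where a: "a \<noteq> 0" "insert 0 F \<subseteq> {x. a \<bullet> x = r}"
      by (rule aff_lowdim_subset_hyperplane)
    \<comment> \<open>Since 0 lies on the hyperplane, \<open>r\<close> is 0.\<close>
    then have aF: "a \<bullet> x = 0" if "x \<in> F" for x using that by auto
    let ?b = "\<lambda>v. if 4 \<le> v then a $ inv lab (Rep v) else 0"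
    let ?a = "\<lambda>e. a $ inv lab (Edge e)"
    interpret tight_annihilator n K u ?b ?a
    proof
      fix \<pi> assume \<pi>: "k_partition n K \<pi>" "\<forall>C\<in>\<pi>. tight u C"
      have "char_vec lab \<pi> \<in> P" unfolding P V_def using \<pi>(1) by (intro hull_inc) auto
      then have "a \<bullet> char_vec lab \<pi> = 0" using f_eq[OF \<pi>(1)] \<pi>(2) by (intro aF) (simp add: F_def)
      then show "(\<Sum>C\<in>\<pi>. block_sum ?b ?a C) = 0"
        using inner_char_vec[OF lab, of \<pi> a] \<pi>(1) by (simp add: k_partition_def)
    qed (use K u in auto)
    \<comment> \<open>Every index is named by some element of \<open>coords n\<close>, so each
      component of \<open>a\<close> is a value of \<open>?b\<close> or \<open>?a\<close> that is
      known to vanish.\<close>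
    have "a $ d = 0" for d
    proof -
      have "inj lab" "lab d \<in> coords n"
        using lab unfolding labelling_def bij_betw_def by auto
      then have "inv lab (lab d) = d" "lab d \<in> Rep ` {4..n} \<union> Edge ` edges n"
        by (auto simp: coords_def)
      then show ?thesis using b_vanishes a_vanishes by force
    qed
    then show False using a(1) by (simp add: vec_eq_iff)
  qed
  moreover have "aff_dim F \<le> ?d - 1" using aff_dim_level_set_le[OF lin F1] by simp
  ultimately have "facet_defining P f 1"
    unfolding facet_defining_def using lin valid dimP by (simp add: F_def)
  then show ?thesis by (simp add: P_def f_def[abs_def])
qed

end
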